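(* Let $\bar\delta>0$ and let $(L_\delta)_{\delta\in[0,\bar\delta)}$ be Markov operators preserving $B_s$ and $B_w$. Suppose that for each $\delta\in[0,\bar\delta)$ there is a probability measure $v_\delta\in B_s$ with $L_\delta v_\delta=v_\delta$, and that there is $\dot Lv_0\in B_s$ such that $$\lim_{\delta\to0}\left\|\frac{L_\delta-L_0}{\delta}v_0-\dot Lv_0\right\|_s=0.$$ Suppose that for each $\delta\in[0,\bar\delta)$ the resolvent operator $(Id-L_\delta)^{-1}$ is defined and bounded from $V_s$ to $V_w$, $\|(Id-L_\delta)^{-1}\|_{V_s\to V_w}<+\infty$, and $$\lim_{\delta\to0}\left\|(Id-L_\delta)^{-1}-(Id-L_0)^{-1}\right\|_{V_s\to V_w}=0.$$ Then $$\lim_{\delta\to0}\left\|\frac{v_\delta-v_0}{\delta}-(Id-L_0)^{-1}\dot Lv_0\right\|_{w}=0.$$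
   Context: $X$ is a compact metric space and $SM(X)$ the space of signed Borel measures on $X$. $(B_s,\|\cdot\|_s)\subseteq(B_w,\|\cdot\|_w)\subseteq SM(X)$ are complete normed vector subspaces with $\|\cdot\|_w\le\|\cdot\|_s$ on $B_s$, and $\mu\mapsto\mu(X)$ is continuous on $B_s$ and on $B_w$. $V_i=\{\mu\in B_i:\mu(X)=0\}$ for $i\in\{s,w\}$. A Markov operator is a linear operator mapping positive measures to positive measures with $[L\mu](X)=\mu(X)$. The resolvent is $(Id-L_\delta)^{-1}:=\sum_{k=0}^\infty L_\delta^k$, the series (applied to an element of $V_s$) converging in $B_w$. $\|A\|_{V_s\to V_w}=\sup_{f\in V_s,\|f\|_s\le1}\|Af\|_w$. *)

theory Defs
  imports "HOL-Analysis.Analysis"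
begin

text \<open>
  A signed Borel measure is a finite real-valued, countably additive set function on the Borel
  sets. Its value off the Borel sets is set to 0, so that equality of elements of the type is
  equality on Borel sets. The value 0 at the empty set follows from countable additivity.
\<close>

definition is_signed_measure :: "('a::topological_space set \<Rightarrow> real) \<Rightarrow> bool" where
  "is_signed_measure m \<longleftrightarrow>
     (\<forall>A. A \<notin> sets borel \<longrightarrow> m A = 0) \<and>
     (\<forall>A :: nat \<Rightarrow> 'a set. range A \<subseteq> sets borel \<longrightarrow> disjoint_family A \<longrightarrow>
        (\<lambda>i. m (A i)) sums m (\<Union>i. A i))"

typedef (overloaded) 'a signed_measure =
    "{m :: 'a::topological_space set \<Rightarrow> real. is_signed_measure m}"
  morphisms smeasure Abs_signed_measure
  by (rule exI[of _ "\<lambda>_. 0"]) (simp add: is_signed_measure_def)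

setup_lifting type_definition_signed_measure

instantiation signed_measure :: (topological_space) real_vector
begin

lift_definition zero_signed_measure :: "'a signed_measure" is "\<lambda>_. 0"
  by (simp add: is_signed_measure_def)

lift_definition plus_signed_measure ::
    "'a signed_measure \<Rightarrow> 'a signed_measure \<Rightarrow> 'a signed_measure" is "\<lambda>m n A. m A + n A"
  by (auto simp: is_signed_measure_def intro!: sums_add)

lift_definition minus_signed_measure ::
    "'a signed_measure \<Rightarrow> 'a signed_measure \<Rightarrow> 'a signed_measure" is "\<lambda>m n A. m A - n A"
  by (auto simp: is_signed_measure_def intro!: sums_diff)

lift_definition uminus_signed_measure :: "'a signed_measure \<Rightarrow> 'a signed_measure" is "\<lambda>m A. - m A"
  by (auto simp: is_signed_measure_def intro!: sums_minus)

lift_definition scaleR_signed_measure :: "real \<Rightarrow> 'a signed_measure \<Rightarrow> 'a signed_measure"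
  is "\<lambda>c m A. c * m A"
  by (auto simp: is_signed_measure_def intro!: sums_mult)

instance
  by standard (transfer; simp add: fun_eq_iff algebra_simps)+

end

lemma finite_measure_is_signed_measure:
  assumes "finite_measure M" and "sets M = sets borel"
  shows "is_signed_measure (measure M)"
  using assms
  by (auto simp: is_signed_measure_def measure_notin_sets intro!: finite_measure.finite_measure_UNION)

definition mass :: "'a::topological_space signed_measure \<Rightarrow> real" where
  "mass \<mu> = smeasure \<mu> UNIV"

definition positive_measure :: "'a::topological_space signed_measure \<Rightarrow> bool" where
  "positive_measure \<mu> \<longleftrightarrow> (\<forall>A \<in> sets borel. 0 \<le> smeasure \<mu> A)"

definition probability_measure :: "'a::topological_space signed_measure \<Rightarrow> bool" where
  "probability_measure \<mu> \<longleftrightarrow> positive_measure \<mu> \<and> mass \<mu> = 1"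

definition markov_operator ::
    "('a::topological_space signed_measure \<Rightarrow> 'a signed_measure) \<Rightarrow> bool" where
  "markov_operator L \<longleftrightarrow> linear L \<and>
     (\<forall>\<mu>. positive_measure \<mu> \<longrightarrow> positive_measure (L \<mu>)) \<and> (\<forall>\<mu>. mass (L \<mu>) = mass \<mu>)"

text \<open>
  The norms of the spaces below are plain functions on the ambient vector space; only their values
  on the subspace they belong to are constrained.
\<close>

definition norm_on :: "'v::real_vector set \<Rightarrow> ('v \<Rightarrow> real) \<Rightarrow> bool" where
  "norm_on B n \<longleftrightarrow>
     (\<forall>x\<in>B. 0 \<le> n x \<and> (n x = 0 \<longleftrightarrow> x = 0)) \<and>
     (\<forall>x\<in>B. \<forall>c. n (c *\<^sub>R x) = \<bar>c\<bar> * n x) \<and>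
     (\<forall>x\<in>B. \<forall>y\<in>B. n (x + y) \<le> n x + n y)"

definition norm_complete :: "'v::real_vector set \<Rightarrow> ('v \<Rightarrow> real) \<Rightarrow> bool" where
  "norm_complete B n \<longleftrightarrow>
     (\<forall>u :: nat \<Rightarrow> 'v. range u \<subseteq> B \<longrightarrow>
        (\<forall>e>0. \<exists>N. \<forall>i\<ge>N. \<forall>j\<ge>N. n (u i - u j) < e) \<longrightarrow>
        (\<exists>x\<in>B. (\<lambda>i. n (u i - x)) \<longlonglongrightarrow> 0))"

definition complete_normed_subspace :: "'v::real_vector set \<Rightarrow> ('v \<Rightarrow> real) \<Rightarrow> bool" where
  "complete_normed_subspace B n \<longleftrightarrow> subspace B \<and> norm_on B n \<and> norm_complete B n"

definition mass_continuous_on ::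
    "'a::topological_space signed_measure set \<Rightarrow> ('a signed_measure \<Rightarrow> real) \<Rightarrow> bool" where
  "mass_continuous_on B n \<longleftrightarrow>
     (\<forall>\<mu>\<in>B. \<forall>e>0. \<exists>d>0. \<forall>\<nu>\<in>B. n (\<nu> - \<mu>) < d \<longrightarrow> \<bar>mass \<nu> - mass \<mu>\<bar> < e)"

definition zero_mass :: "'a::topological_space signed_measure set \<Rightarrow> 'a signed_measure set" where
  "zero_mass B = {\<mu> \<in> B. mass \<mu> = 0}"

definition neumann_sum ::
    "'v::real_vector set \<Rightarrow> ('v \<Rightarrow> real) \<Rightarrow> ('v \<Rightarrow> 'v) \<Rightarrow> 'v \<Rightarrow> 'v \<Rightarrow> bool" where
  "neumann_sum B n L f g \<longleftrightarrow> g \<in> B \<and> (\<lambda>N. n ((\<Sum>k<N. (L ^^ k) f) - g)) \<longlonglongrightarrow> 0"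

definition resolvent_defined ::
    "'v::real_vector set \<Rightarrow> 'v set \<Rightarrow> ('v \<Rightarrow> real) \<Rightarrow> ('v \<Rightarrow> 'v) \<Rightarrow> bool" where
  "resolvent_defined V B n L \<longleftrightarrow> (\<forall>f\<in>V. \<exists>g. neumann_sum B n L f g)"

text \<open>
  The sum of the Neumann series is unique when the norm is a norm on the subspace \<open>B\<close> and the
  partial sums lie in \<open>B\<close>.
\<close>

definition resolvent ::
    "'v::real_vector set \<Rightarrow> ('v \<Rightarrow> real) \<Rightarrow> ('v \<Rightarrow> 'v) \<Rightarrow> 'v \<Rightarrow> 'v" where
  "resolvent B n L f = (THE g. neumann_sum B n L f g)"

text \<open>
  The supremum is taken in the extended reals, so that an unbounded operator has norm \<open>\<infinity>\<close>.
\<close>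

definition op_norm ::
    "'v::real_vector set \<Rightarrow> ('v \<Rightarrow> real) \<Rightarrow> ('v \<Rightarrow> real) \<Rightarrow> ('v \<Rightarrow> 'v) \<Rightarrow> ereal" where
  "op_norm V n n' A = (SUP f\<in>{f \<in> V. n f \<le> 1}. ereal (n' (A f)))"

end

theory Submission
  imports Defs
begin

text \<open>
  Put \<open>R\<^sub>\<delta> = (Id - L\<^sub>\<delta>)\<^sup>-\<^sup>1\<close>, \<open>w\<^sub>\<delta> = (v\<^sub>\<delta>
  - v\<^sub>0) / \<delta>\<close> and \<open>h\<^sub>\<delta> = (L\<^sub>\<delta> v\<^sub>0 - L\<^sub>0 v\<^sub>0) /
  \<delta>\<close>. Since \<open>v\<^sub>\<delta>\<close> and \<open>v\<^sub>0\<close> are fixed points, \<open>(Id -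
  L\<^sub>\<delta>) w\<^sub>\<delta> = h\<^sub>\<delta>\<close>. This can be inverted to \<open>w\<^sub>\<delta> =
  R\<^sub>\<delta> h\<^sub>\<delta>\<close>, because the partial sums of the Neumann series at
  \<open>h\<^sub>\<delta>\<close> telescope to \<open>w\<^sub>\<delta> - L\<^sub>\<delta>\<^sup>N w\<^sub>\<delta>\<close>,
  and \<open>L\<^sub>\<delta>\<^sup>N w\<^sub>\<delta>\<close> is the general term of the Neumann series at
  \<open>w\<^sub>\<delta>\<close>, which converges in the weak norm as \<open>w\<^sub>\<delta>\<close> has mass zero
  (\<open>resolvent_diff_apply\<close>). Writing \<open>h\<close> for the derivative of \<open>L\<^sub>\<delta>
  v\<^sub>0\<close> at zero, the error splits as \<open>w\<^sub>\<delta> - R\<^sub>0 h = (R\<^sub>\<delta> - R\<^sub>0)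
  h\<^sub>\<delta> + R\<^sub>0 (h\<^sub>\<delta> - h)\<close>, where linearity of \<open>R\<^sub>0\<close> is inherited from
  the uniqueness of Neumann sums (\<open>resolvent_eqI\<close>). The first term tends to zero because \<open>R\<^sub>\<delta>
  \<rightarrow> R\<^sub>0\<close> in operator norm and \<open>h\<^sub>\<delta>\<close> stays bounded in the strong norm; the
  second because \<open>R\<^sub>0\<close> is bounded and \<open>h\<^sub>\<delta> \<rightarrow> h\<close> in the strong norm.
  Both estimates (\<open>op_norm_bound\<close>) apply to mass-zero measures only: \<open>h\<^sub>\<delta>\<close> is one
  because Markov operators preserve mass, and \<open>h\<close> is one because the mass is continuous
  (\<open>mass_eq_0_limit\<close>).
\<close>

section \<open>Norms on subspaces\<close>

lemma norm_on_nonneg: "norm_on B n \<Longrightarrow> x \<in> B \<Longrightarrow> 0 \<le> n x"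
  unfolding norm_on_def by blast

lemma norm_on_scaleR: "norm_on B n \<Longrightarrow> x \<in> B \<Longrightarrow> n (c *\<^sub>R x) = \<bar>c\<bar> * n x"
  unfolding norm_on_def by blast

lemma norm_on_subset: "norm_on B n \<Longrightarrow> V \<subseteq> B \<Longrightarrow> norm_on V n"
  unfolding norm_on_def subset_iff by simp

lemma norm_on_minus_commute:
  assumes "subspace B" "norm_on B n" "x \<in> B" "y \<in> B"
  shows "n (x - y) = n (y - x)"
proof -
  have "y - x \<in> B" using assms by (simp add: subspace_diff)
  from norm_on_scaleR[OF assms(2) this, of "-1"] show ?thesis by simp
qed

lemma norm_on_triangle_diff:
  assumes "subspace B" "norm_on B n" "x \<in> B" "y \<in> B" "z \<in> B"
  shows "n (x - z) \<le> n (x - y) + n (y - z)"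
proof -
  have "x - y \<in> B" "y - z \<in> B" using assms by (simp_all add: subspace_diff)
  then have "n ((x - y) + (y - z)) \<le> n (x - y) + n (y - z)"
    using assms(2) unfolding norm_on_def by blast
  then show ?thesis by simp
qed

lemma norm_on_lim_unique:
  assumes B: "subspace B" "norm_on B n"
    and u: "\<And>N::nat. u N \<in> B" and gh: "g \<in> B" "h \<in> B"
    and g: "(\<lambda>N. n (u N - g)) \<longlonglongrightarrow> 0" and h: "(\<lambda>N. n (u N - h)) \<longlonglongrightarrow> 0"
  shows "g = h"
proof -
  have "n (g - h) \<le> n (u N - g) + n (u N - h)" for N
    using norm_on_triangle_diff[OF B gh(1) u[of N] gh(2)]
      norm_on_minus_commute[OF B gh(1) u[of N]] by simp
  then have "n (g - h) \<le> 0"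
    using tendsto_add[OF g h]
    by (intro tendsto_lowerbound[of _ 0 sequentially]) auto
  moreover have "g - h \<in> B" using B gh by (simp add: subspace_diff)
  ultimately have "g - h = 0"
    using B(2) unfolding norm_on_def by (meson order_antisym)
  then show ?thesis by simp
qed

section \<open>The Neumann series and the resolvent\<close>

lemma tendsto_0_between:
  fixes a b :: "nat \<Rightarrow> real"
  assumes "\<And>N. a N \<le> b N" "\<And>N. 0 \<le> a N" "b \<longlonglongrightarrow> 0"
  shows "a \<longlonglongrightarrow> 0"
  using tendsto_sandwich[of "\<lambda>_. 0" a sequentially b 0] assms by simp

lemma linear_funpow:
  fixes L :: "'v::real_vector \<Rightarrow> 'v"
  assumes "linear L"
  shows "linear (L ^^ k)"
proof (induction k)
  case 0
  show ?case using linear_id by (simp add: id_def)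
next
  case (Suc k)
  then show ?case using linear_compose[OF _ assms] by (simp add: o_def)
qed

lemma funpow_in:
  assumes "L ` B \<subseteq> B" "f \<in> B"
  shows "(L ^^ k) f \<in> B"
  using assms by (induction k) auto

lemma neumann_partial_sum_in:
  assumes "subspace B" "L ` B \<subseteq> B" "f \<in> B"
  shows "(\<Sum>k<N. (L ^^ k) f) \<in> B"
  using assms by (intro subspace_sum funpow_in)

lemma resolvent_eqI:
  assumes "subspace B" "norm_on B n" "L ` B \<subseteq> B" "f \<in> B"
    and "neumann_sum B n L f g"
  shows "resolvent B n L f = g"
  unfolding resolvent_def
proof (rule the_equality)
  show "neumann_sum B n L f g" by fact
next
  fix g' assume "neumann_sum B n L f g'"
  with assms(5) show "g' = g"
    unfolding neumann_sum_def
    by (intro norm_on_lim_unique[OF assms(1,2) neumann_partial_sum_in[OF assms(1,3,4)], of g' g]) auto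
qed

lemma neumann_sum_resolvent:
  assumes "subspace B" "norm_on B n" "L ` B \<subseteq> B" "V \<subseteq> B"
    and "resolvent_defined V B n L" "f \<in> V"
  shows "neumann_sum B n L f (resolvent B n L f)"
proof -
  obtain g where g: "neumann_sum B n L f g"
    using assms(5,6) unfolding resolvent_defined_def by blast
  then show ?thesis using resolvent_eqI[OF assms(1-3) _ g] assms(4,6) by auto
qed

lemma neumann_sum_scale:
  assumes B: "subspace B" "norm_on B n" "L ` B \<subseteq> B" and L: "linear L"
    and f: "f \<in> B" and g: "neumann_sum B n L f g"
  shows "neumann_sum B n L (c *\<^sub>R f) (c *\<^sub>R g)"
proof -
  have gB: "g \<in> B" and lim: "(\<lambda>N. n ((\<Sum>k<N. (L ^^ k) f) - g)) \<longlonglongrightarrow> 0"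
    using g unfolding neumann_sum_def by auto
  have "(\<Sum>k<N. (L ^^ k) (c *\<^sub>R f)) - c *\<^sub>R g = c *\<^sub>R ((\<Sum>k<N. (L ^^ k) f) - g)" for N
    using linear_funpow[OF L] by (simp add: linear_scale scaleR_sum_right scaleR_diff_right)
  moreover have "(\<Sum>k<N. (L ^^ k) f) - g \<in> B" for N
    using neumann_partial_sum_in[OF B(1,3) f] gB B(1) by (simp add: subspace_diff)
  ultimately have "n ((\<Sum>k<N. (L ^^ k) (c *\<^sub>R f)) - c *\<^sub>R g) = \<bar>c\<bar> * n ((\<Sum>k<N. (L ^^ k) f) - g)" for N
    using norm_on_scaleR[OF B(2)] by simp
  then show ?thesis
    using tendsto_mult_right_zero[OF lim, of "\<bar>c\<bar>"] gB B(1)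
    unfolding neumann_sum_def by (simp add: subspace_scale)
qed

lemma neumann_sum_diff:
  assumes B: "subspace B" "norm_on B n" "L ` B \<subseteq> B" and L: "linear L"
    and f: "f \<in> B" "f' \<in> B" and g: "neumann_sum B n L f g" "neumann_sum B n L f' g'"
  shows "neumann_sum B n L (f - f') (g - g')"
proof -
  let ?S = "\<lambda>f N. \<Sum>k<N. (L ^^ k) f"
  have gB: "g \<in> B" "g' \<in> B"
    and lim: "(\<lambda>N. n (?S f N - g)) \<longlonglongrightarrow> 0" "(\<lambda>N. n (?S f' N - g')) \<longlonglongrightarrow> 0"
    using g unfolding neumann_sum_def by auto
  have eq: "?S (f - f') N - (g - g') = (?S f N - g) - (?S f' N - g')" for N
    using linear_funpow[OF L] by (simp add: linear_diff sum_subtractf)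
  have inB: "?S f N - g \<in> B" "?S f' N - g' \<in> B" for N
    using neumann_partial_sum_in[OF B(1,3)] f gB B(1) by (simp_all add: subspace_diff)
  have "n (?S (f - f') N - (g - g')) \<le> n (?S f N - g) + n (?S f' N - g')" for N
    using norm_on_triangle_diff[OF B(1,2) inB(1)[of N] subspace_0[OF B(1)] inB(2)[of N]]
      norm_on_minus_commute[OF B(1,2) subspace_0[OF B(1)] inB(2)[of N]]
    by (simp add: eq)
  moreover have "0 \<le> n (?S (f - f') N - (g - g'))" for N
    unfolding eq using norm_on_nonneg[OF B(2)] subspace_diff[OF B(1) inB[of N]] .
  ultimately have "(\<lambda>N. n (?S (f - f') N - (g - g'))) \<longlonglongrightarrow> 0"
    by (rule tendsto_0_between[OF _ _ tendsto_add_zero[OF lim]])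
  then show ?thesis
    using gB B(1) unfolding neumann_sum_def by (simp add: subspace_diff)
qed

text \<open>The resolvent is a definite description, so its linearity is derived from that of the relation
  \<open>neumann_sum\<close>, on the elements where the series converges.\<close>

lemma resolvent_scale:
  assumes "subspace B" "norm_on B n" "L ` B \<subseteq> B" "linear L" "V \<subseteq> B"
    and "resolvent_defined V B n L" "f \<in> V"
  shows "resolvent B n L (c *\<^sub>R f) = c *\<^sub>R resolvent B n L f"
proof (rule resolvent_eqI)
  show "neumann_sum B n L (c *\<^sub>R f) (c *\<^sub>R resolvent B n L f)"
    using neumann_sum_scale[OF assms(1-4) _ neumann_sum_resolvent[OF assms(1-3,5-7)]] assms(5,7)
    by blast
  show "c *\<^sub>R f \<in> B" using assms(5,7) by (intro subspace_scale[OF assms(1)]) blast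
qed (rule assms)+

lemma resolvent_diff:
  assumes "subspace B" "norm_on B n" "L ` B \<subseteq> B" "linear L" "V \<subseteq> B"
    and "resolvent_defined V B n L" "f \<in> V" "g \<in> V"
  shows "resolvent B n L (f - g) = resolvent B n L f - resolvent B n L g"
proof (rule resolvent_eqI)
  show "neumann_sum B n L (f - g) (resolvent B n L f - resolvent B n L g)"
    using neumann_sum_diff[OF assms(1-4) _ _ neumann_sum_resolvent[OF assms(1-3,5-7)]
        neumann_sum_resolvent[OF assms(1-3,5,6,8)]] assms(5,7,8)
    by blast
  show "f - g \<in> B" using assms(5,7,8) by (intro subspace_diff[OF assms(1)]) blast+
qed (rule assms)+

text \<open>The terms of a series that converges in norm tend to zero: each is a difference of two
  consecutive partial sums.\<close>

lemma neumann_sum_terms_tendsto_0: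
  assumes B: "subspace B" "norm_on B n" "L ` B \<subseteq> B" and f: "f \<in> B"
    and g: "neumann_sum B n L f g"
  shows "(\<lambda>N. n ((L ^^ N) f)) \<longlonglongrightarrow> 0"
proof -
  let ?S = "\<lambda>N. \<Sum>k<N. (L ^^ k) f"
  have gB: "g \<in> B" and lim: "(\<lambda>N. n (?S N - g)) \<longlonglongrightarrow> 0"
    using g unfolding neumann_sum_def by auto
  have SB: "?S N \<in> B" for N by (rule neumann_partial_sum_in[OF B(1,3) f])
  have "n ((L ^^ N) f) \<le> n (?S (Suc N) - g) + n (?S N - g)" for N
    using norm_on_triangle_diff[OF B(1,2) SB[of "Suc N"] gB SB[of N]]
      norm_on_minus_commute[OF B(1,2) gB SB[of N]] by simp
  moreover have "0 \<le> n ((L ^^ N) f)" for N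
    by (rule norm_on_nonneg[OF B(2) funpow_in[OF B(3) f]])
  ultimately show ?thesis
    by (rule tendsto_0_between[OF _ _ tendsto_add_zero[OF LIMSEQ_Suc[OF lim] lim]])
qed

text \<open>The resolvent is a left inverse of \<open>Id - L\<close>. The partial sums at \<open>f - L f\<close> telescope to
  \<open>f - L\<^sup>N f\<close>, and \<open>L\<^sup>N f \<rightarrow> 0\<close> because the Neumann series at \<open>f\<close> itself converges.\<close>

lemma resolvent_diff_apply:
  assumes B: "subspace B" "norm_on B n" "L ` B \<subseteq> B" and L: "linear L"
    and V: "V \<subseteq> B" "resolvent_defined V B n L" and f: "f \<in> V"
  shows "resolvent B n L (f - L f) = f"
proof (rule resolvent_eqI[OF B])
  have fB: "f \<in> B" using V f by blast
  then show "f - L f \<in> B" using B by (auto intro: subspace_diff)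
  have tele: "(\<Sum>k<N. (L ^^ k) (f - L f)) = f - (L ^^ N) f" for N
  proof (induction N)
    case (Suc N)
    then show ?case
      using linear_funpow[OF L] by (simp add: linear_diff funpow_swap1)
  qed simp
  have "n ((\<Sum>k<N. (L ^^ k) (f - L f)) - f) = n ((L ^^ N) f)" for N
    using norm_on_minus_commute[OF B(1,2) subspace_0[OF B(1)] funpow_in[OF B(3) fB]]
    by (simp add: tele)
  then show "neumann_sum B n L (f - L f) f"
    using neumann_sum_terms_tendsto_0[OF B fB neumann_sum_resolvent[OF B V f]] fB
    unfolding neumann_sum_def by simp
qed

section \<open>The operator norm\<close>

text \<open>The supremum over the unit ball controls \<open>A\<close> at \<open>f / n f\<close>, and homogeneity of \<open>A\<close> and of both
  norms carries the bound over to \<open>f\<close>.\<close>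

lemma op_norm_bound:
  assumes V: "subspace V" "norm_on V n"
    and B: "norm_on B n'" "A ` V \<subseteq> B"
    and hom: "\<And>c f. f \<in> V \<Longrightarrow> A (c *\<^sub>R f) = c *\<^sub>R A f"
    and C: "op_norm V n n' A \<le> ereal C" and f: "f \<in> V"
  shows "n' (A f) \<le> C * n f"
proof (cases "f = 0")
  case True
  have "A f = 0" using hom[OF f, of 0] True by simp
  moreover from this have "0 \<in> B" using B(2) f by (metis image_subset_iff)
  then have "n' 0 = 0" using B(1) unfolding norm_on_def by blast
  moreover have "n 0 = 0" using V(2) f True unfolding norm_on_def by blast
  ultimately show ?thesis using True by simp
next
  case False
  then have pos: "n f > 0" using V(2) f unfolding norm_on_def by (metis order_le_less)
  let ?u = "inverse (n f) *\<^sub>R f"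
  have u: "?u \<in> V" using V f by (simp add: subspace_scale)
  have "n ?u = 1" using norm_on_scaleR[OF V(2) f] pos by simp
  then have "ereal (n' (A ?u)) \<le> op_norm V n n' A"
    using u unfolding op_norm_def by (intro SUP_upper) simp
  then have "n' (A ?u) \<le> C" using C by (metis ereal_less_eq(3) order_trans)
  moreover have "n' (A ?u) = inverse (n f) * n' (A f)"
    using hom[OF f] norm_on_scaleR[OF B(1), of "A f"] B(2) f pos by (simp add: image_subset_iff)
  ultimately have "inverse (n f) * n' (A f) \<le> C" by simp
  then show ?thesis using pos by (simp add: field_simps)
qed

section \<open>Measures of mass zero\<close>

lemma mass_diff: "mass (\<mu> - \<nu>) = mass \<mu> - mass \<nu>"
  unfolding mass_def by transfer simp

lemma mass_scaleR: "mass (c *\<^sub>R \<mu>) = c * mass \<mu>"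
  unfolding mass_def by transfer simp

lemma subspace_zero_mass:
  fixes B :: "'a::topological_space signed_measure set"
  assumes "subspace B"
  shows "subspace (zero_mass B)"
proof -
  have add: "mass (\<mu> + \<nu>) = mass \<mu> + mass \<nu>" for \<mu> \<nu> :: "'a signed_measure"
    unfolding mass_def by transfer simp
  have "mass (0 :: 'a signed_measure) = 0" unfolding mass_def by transfer simp
  with assms add show ?thesis
    unfolding subspace_def zero_mass_def by (simp add: mass_scaleR)
qed

text \<open>Membership of the derivative in \<open>V\<^sub>s\<close>, where the resolvent is defined and bounded, comes from
  this closedness of the zero-mass subspace.\<close>

lemma mass_eq_0_limit:
  assumes B: "subspace B" and cont: "mass_continuous_on B n"
    and F: "F \<noteq> bot" and h: "h \<in> B"
    and ev: "\<forall>\<^sub>F x in F. u x \<in> zero_mass B" and lim: "((\<lambda>x. n (u x - h)) \<longlongrightarrow> 0) F"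
  shows "mass h = 0"
proof (rule ccontr)
  assume "mass h \<noteq> 0"
  then obtain d where d: "d > 0" "\<And>\<nu>. \<nu> \<in> B \<Longrightarrow> n (\<nu> - h) < d \<Longrightarrow> \<bar>mass \<nu> - mass h\<bar> < \<bar>mass h\<bar>"
    using cont h unfolding mass_continuous_on_def by (metis zero_less_abs_iff)
  have "\<forall>\<^sub>F x in F. n (u x - h) < d" using order_tendstoD(2)[OF lim d(1)] .
  with ev have "\<forall>\<^sub>F x in F. False"
  proof eventually_elim
    case (elim x)
    then show ?case using d(2)[of "u x"] by (simp add: zero_mass_def)
  qed
  then show False using F by simp
qed

section \<open>Linear response\<close>

theorem theorem53:
  fixes Bs Bw :: "'a::metric_space signed_measure set"
    and ns nw :: "'a signed_measure \<Rightarrow> real"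
    and \<delta>bar :: real
    and L :: "real \<Rightarrow> 'a signed_measure \<Rightarrow> 'a signed_measure"
    and v :: "real \<Rightarrow> 'a signed_measure"
    and Ldot_v0 :: "'a signed_measure"
  assumes compact_X: "compact (UNIV :: 'a set)"
    and Bs: "complete_normed_subspace Bs ns"
    and Bw: "complete_normed_subspace Bw nw"
    and Bs_subset_Bw: "Bs \<subseteq> Bw"
    and norm_le: "\<And>\<mu>. \<mu> \<in> Bs \<Longrightarrow> nw \<mu> \<le> ns \<mu>"
    and mass_Bs: "mass_continuous_on Bs ns"
    and mass_Bw: "mass_continuous_on Bw nw"
    and \<delta>bar_pos: "0 < \<delta>bar"
    and markov: "\<And>\<delta>. \<delta> \<in> {0..<\<delta>bar} \<Longrightarrow> markov_operator (L \<delta>)"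
    and preserves_Bs: "\<And>\<delta>. \<delta> \<in> {0..<\<delta>bar} \<Longrightarrow> L \<delta> ` Bs \<subseteq> Bs"
    and preserves_Bw: "\<And>\<delta>. \<delta> \<in> {0..<\<delta>bar} \<Longrightarrow> L \<delta> ` Bw \<subseteq> Bw"
    and v_in_Bs: "\<And>\<delta>. \<delta> \<in> {0..<\<delta>bar} \<Longrightarrow> v \<delta> \<in> Bs"
    and v_prob: "\<And>\<delta>. \<delta> \<in> {0..<\<delta>bar} \<Longrightarrow> probability_measure (v \<delta>)"
    and v_fixed: "\<And>\<delta>. \<delta> \<in> {0..<\<delta>bar} \<Longrightarrow> L \<delta> (v \<delta>) = v \<delta>"
    and Ldot_in_Bs: "Ldot_v0 \<in> Bs"
    and Ldot_lim:
      "((\<lambda>\<delta>. ns ((L \<delta> (v 0) - L 0 (v 0)) /\<^sub>R \<delta> - Ldot_v0)) \<longlongrightarrow> 0) (at 0 within {0..<\<delta>bar})"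
    and res_defined:
      "\<And>\<delta>. \<delta> \<in> {0..<\<delta>bar} \<Longrightarrow> resolvent_defined (zero_mass Bs) Bw nw (L \<delta>)"
    and res_bounded:
      "\<And>\<delta>. \<delta> \<in> {0..<\<delta>bar} \<Longrightarrow> op_norm (zero_mass Bs) ns nw (resolvent Bw nw (L \<delta>)) < \<infinity>"
    and res_lim:
      "((\<lambda>\<delta>. op_norm (zero_mass Bs) ns nw
               (\<lambda>f. resolvent Bw nw (L \<delta>) f - resolvent Bw nw (L 0) f)) \<longlongrightarrow> 0)
         (at 0 within {0..<\<delta>bar})"
  shows "((\<lambda>\<delta>. nw ((v \<delta> - v 0) /\<^sub>R \<delta> - resolvent Bw nw (L 0) Ldot_v0)) \<longlongrightarrow> 0)
           (at 0 within {0..<\<delta>bar})"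
proof -
  let ?F = "at 0 within {0..<\<delta>bar}"
  let ?V = "zero_mass Bs"
  define R where "R = (\<lambda>\<delta>. resolvent Bw nw (L \<delta>))"
  define w where "w = (\<lambda>\<delta>. (v \<delta> - v 0) /\<^sub>R \<delta>)"
  define h where "h = (\<lambda>\<delta>. (L \<delta> (v 0) - L 0 (v 0)) /\<^sub>R \<delta>)"
  have s: "subspace Bs" "norm_on Bs ns" and bw: "subspace Bw" "norm_on Bw nw"
    using Bs Bw unfolding complete_normed_subspace_def by auto
  have VBs: "?V \<subseteq> Bs" unfolding zero_mass_def by auto
  then have VBw: "?V \<subseteq> Bw" using Bs_subset_Bw by blast
  have V: "subspace ?V" "norm_on ?V ns"
    using subspace_zero_mass[OF s(1)] norm_on_subset[OF s(2) VBs] by auto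
  have zero: "0 \<in> {0..<\<delta>bar}" using \<delta>bar_pos by simp
  have lin: "linear (L \<delta>)" and mass_L: "mass (L \<delta> \<mu>) = mass \<mu>" if "\<delta> \<in> {0..<\<delta>bar}" for \<delta> \<mu>
    using markov[OF that] unfolding markov_operator_def by auto
  have ev: "\<forall>\<^sub>F \<delta> in ?F. \<delta> \<in> {0..<\<delta>bar} \<and> \<delta> \<noteq> 0"
    unfolding eventually_at_filter by simp
  have nontriv: "?F \<noteq> bot"
    using \<delta>bar_pos by (simp add: trivial_limit_within)
  have RBw: "R \<delta> f \<in> Bw" if "\<delta> \<in> {0..<\<delta>bar}" "f \<in> ?V" for \<delta> f
    using neumann_sum_resolvent[OF bw preserves_Bw[OF that(1)] VBw res_defined[OF that(1)] that(2)]
    unfolding R_def neumann_sum_def by simp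
  have Rscale: "R \<delta> (c *\<^sub>R f) = c *\<^sub>R R \<delta> f" if "\<delta> \<in> {0..<\<delta>bar}" "f \<in> ?V" for \<delta> c f
    unfolding R_def
    using resolvent_scale[OF bw preserves_Bw lin VBw res_defined] that by blast
  have hV: "h \<delta> \<in> ?V" if d: "\<delta> \<in> {0..<\<delta>bar}" for \<delta>
    using preserves_Bs[OF d] preserves_Bs[OF zero] v_in_Bs[OF zero] s(1)
    unfolding h_def zero_mass_def
    by (auto simp: mass_scaleR mass_diff mass_L[OF d] mass_L[OF zero]
        intro!: subspace_scale subspace_diff)
  have hlim: "((\<lambda>\<delta>. ns (h \<delta> - Ldot_v0)) \<longlongrightarrow> 0) ?F"
    using Ldot_lim unfolding h_def .
  have LdV: "Ldot_v0 \<in> ?V"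
    using mass_eq_0_limit[OF s(1) mass_Bs nontriv Ldot_in_Bs eventually_mono[OF ev] hlim] hV Ldot_in_Bs
    by (simp add: zero_mass_def)

  \<comment> \<open>The fixed point equations turn the resolvent identity into \<open>w\<^sub>\<delta> = R\<^sub>\<delta> h\<^sub>\<delta>\<close>.\<close>
  have w_eq: "w \<delta> = R \<delta> (h \<delta>)" if d: "\<delta> \<in> {0..<\<delta>bar}" for \<delta>
  proof -
    have "w \<delta> \<in> ?V"
      using v_in_Bs[OF d] v_in_Bs[OF zero] v_prob[OF d] v_prob[OF zero] s(1)
      unfolding w_def zero_mass_def probability_measure_def
      by (auto simp: mass_scaleR mass_diff intro!: subspace_scale subspace_diff)
    moreover have "L \<delta> (w \<delta>) = (v \<delta> - L \<delta> (v 0)) /\<^sub>R \<delta>"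
      by (simp add: w_def linear_scale[OF lin[OF d]] linear_diff[OF lin[OF d]] v_fixed[OF d])
    then have "w \<delta> - L \<delta> (w \<delta>) = h \<delta>"
      by (simp add: w_def h_def v_fixed[OF zero] scaleR_diff_right)
    ultimately show ?thesis
      using resolvent_diff_apply[OF bw preserves_Bw[OF d] lin[OF d] VBw res_defined[OF d], of "w \<delta>"]
      unfolding R_def by simp
  qed

  obtain C where C: "\<And>f. f \<in> ?V \<Longrightarrow> nw (R 0 f) \<le> C * ns f"
  proof -
    have "op_norm ?V ns nw (R 0) \<noteq> \<infinity>"
      using res_bounded[OF zero] unfolding R_def by simp
    then obtain C where "op_norm ?V ns nw (R 0) < ereal C"
      unfolding less_PInf_Ex_of_nat by blast
    then have C: "op_norm ?V ns nw (R 0) \<le> ereal C" by (rule less_imp_le)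
    show ?thesis
      by (rule that[of C], rule op_norm_bound[OF V bw(2) _ _ C]) (use zero RBw Rscale in auto)
  qed
  have lim2: "((\<lambda>\<delta>. C * ns (h \<delta> - Ldot_v0)) \<longlongrightarrow> 0) ?F"
    using tendsto_mult_right_zero[OF hlim] .

  \<comment> \<open>\<open>M\<close> bounds the strong norm of \<open>h\<^sub>\<delta>\<close> for small \<open>\<delta>\<close>.\<close>
  define M where "M = ns Ldot_v0 + 1"
  have M: "M > 0" using norm_on_nonneg[OF s(2) Ldot_in_Bs] by (simp add: M_def)
  have hM: "\<forall>\<^sub>F \<delta> in ?F. ns (h \<delta>) \<le> M"
    using order_tendstoD(2)[OF hlim, of 1, simplified] ev
  proof eventually_elim
    case (elim \<delta>)
    then have "h \<delta> \<in> Bs" using hV VBs by blast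
    from norm_on_triangle_diff[OF s this Ldot_in_Bs subspace_0[OF s(1)]] elim
    show ?case by (simp add: M_def)
  qed
  have lim1: "((\<lambda>\<delta>. nw (R \<delta> (h \<delta>) - R 0 (h \<delta>))) \<longlongrightarrow> 0) ?F"
  proof (rule tendstoI)
    fix e :: real assume e: "e > 0"
    have "\<forall>\<^sub>F \<delta> in ?F. op_norm ?V ns nw (\<lambda>f. R \<delta> f - R 0 f) < ereal (e / (2 * M))"
      using order_tendstoD(2)[OF res_lim, of "ereal (e / (2 * M))"] e M unfolding R_def by simp
    then show "\<forall>\<^sub>F \<delta> in ?F. dist (nw (R \<delta> (h \<delta>) - R 0 (h \<delta>))) 0 < e"
      using ev hM
    proof eventually_elim
      case (elim \<delta>)
      then have d: "\<delta> \<in> {0..<\<delta>bar}" by simp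
      have "nw (R \<delta> (h \<delta>) - R 0 (h \<delta>)) \<le> e / (2 * M) * ns (h \<delta>)"
        by (rule op_norm_bound[OF V bw(2) _ _ less_imp_le[OF elim(1)] hV[OF d]])
          (use zero d RBw Rscale bw(1) in \<open>auto simp: scaleR_diff_right intro!: subspace_diff\<close>)
      also have "\<dots> \<le> e / (2 * M) * M" using elim(3) e M by (intro mult_left_mono) auto
      also have "\<dots> < e" using e M by simp
      finally have "nw (R \<delta> (h \<delta>) - R 0 (h \<delta>)) < e" .
      moreover have "0 \<le> nw (R \<delta> (h \<delta>) - R 0 (h \<delta>))"
        by (intro norm_on_nonneg[OF bw(2)] subspace_diff[OF bw(1)] RBw d zero hV)
      ultimately show ?case by simp
    qed
  qed

  have nonneg: "\<forall>\<^sub>F \<delta> in ?F. 0 \<le> nw (w \<delta> - R 0 Ldot_v0)"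
    using ev
  proof eventually_elim
    case (elim \<delta>)
    then have "w \<delta> - R 0 Ldot_v0 \<in> Bw"
      using w_eq RBw hV zero LdV bw(1) by (simp add: subspace_diff)
    then show ?case by (rule norm_on_nonneg[OF bw(2)])
  qed
  have upper: "\<forall>\<^sub>F \<delta> in ?F. nw (w \<delta> - R 0 Ldot_v0)
      \<le> nw (R \<delta> (h \<delta>) - R 0 (h \<delta>)) + C * ns (h \<delta> - Ldot_v0)"
    using ev
  proof eventually_elim
    case (elim \<delta>)
    then have d: "\<delta> \<in> {0..<\<delta>bar}" by simp
    have "nw (w \<delta> - R 0 Ldot_v0) \<le> nw (R \<delta> (h \<delta>) - R 0 (h \<delta>)) + nw (R 0 (h \<delta>) - R 0 Ldot_v0)"
      unfolding w_eq[OF d] using hV[OF d] LdV d zero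
      by (intro norm_on_triangle_diff[OF bw] RBw)
    also have "R 0 (h \<delta>) - R 0 Ldot_v0 = R 0 (h \<delta> - Ldot_v0)"
      unfolding R_def
      using resolvent_diff[OF bw preserves_Bw lin VBw res_defined] zero hV[OF d] LdV by simp
    also have "nw (R 0 (h \<delta> - Ldot_v0)) \<le> C * ns (h \<delta> - Ldot_v0)"
      using C hV[OF d] LdV V(1) by (simp add: subspace_diff)
    finally show ?case by simp
  qed
  have "((\<lambda>\<delta>. nw (w \<delta> - R 0 Ldot_v0)) \<longlongrightarrow> 0) ?F"
    using tendsto_sandwich[OF nonneg upper tendsto_const] tendsto_add[OF lim1 lim2] by simp
  then show ?thesis unfolding w_def R_def .
qed

end
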